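(* Let $\mu$ and $\mu'$ be shift-invariant Borel probability measures on $\Omega_\pm$, and let $\lambda$ and $\lambda'$ be the measures obtained from the ergodic decomposition applied to $\mu$ and $\mu'$, respectively. If the $\mu\times\mu'\times\mu_N$-measure of the set of all $(\omega,\omega',\mathbf v)\in X$ without stable periodic orbits is zero, then for $\lambda$-a.e. (and for $\lambda'$-a.e.) $\nu\in\mathcal E$ we have $\int_{\Omega_\pm}\omega_0\,d\nu(\omega)=0$.
   Context: $\Omega_\pm=\{\pm1\}^{\mathbb Z}$ with the product topology, $\sigma(\omega)_n=\omega_{n+1}$, $N=\{(1,0),(0,1),(-1,0),(0,-1)\}$, $\mu_N$ the uniform probability measure on $N$, $X=\Omega_\pm\times\Omega_\pm\times N$, and $$\Phi(\omega,\omega',(a,b))=(\sigma^{sb}(\omega),\sigma^{sa}(\omega'),s(b,a)),\qquad s=\omega_0\omega'_0 .$$ A point $(\omega,\omega',\mathbf v)\in X$ has a stable periodic orbit if for some $n\ge1$ there are open neighborhoods $U$ of $\omega$ and $U'$ of $\omega'$ such that $\Phi^n(\eta,\eta',\mathbf v)=(\eta,\eta',\mathbf v)$ for all $(\eta,\eta')\in U\times U'$. Ergodic decomposition: let $\mathcal E$ denote the set of ergodic shift-invariant Borel probability measures on $\Omega_\pm$, inside the space of all shift-invariant Borel probability measures. For a shift-invariant probability measure $\mu$ there is a unique probability measure $\lambda$ on the space of shift-invariant probability measures with $\lambda(\mathcal E)=1$ and $\int_{\Omega_\pm}f\,d\mu=\int_{\mathcal E}\int_{\Omega_\pm}f\,d\nu\,d\lambda(\nu)$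 for all continuous $f:\Omega_\pm\to\mathbb R$. *)

theory Defs
  imports "HOL-Probability.Probability"
begin

instance int :: second_countable_topology
proof
  have "open = generate_topology (range (\<lambda>n::int. {n}))"
  proof (intro ext iffI)
    fix S :: "int set"
    have "generate_topology (range (\<lambda>n::int. {n})) (\<Union>n\<in>S. {n})"
      by (intro generate_topology_Union generate_topology.Basis) auto
    then show "generate_topology (range (\<lambda>n::int. {n})) S"
      by simp
  qed (rule Topological_Spaces.open_discrete)
  then show "\<exists>B::int set set. countable B \<and> open = generate_topology B"
    by (intro exI[of _ "range (\<lambda>n::int. {n})"]) auto
qed

text \<open>Since \<open>int\<close> is discrete, the subspace topology inherited from \<open>int \<Rightarrow> int\<close> is the
  product topology of the two-point discrete space.\<close>

definition Omega :: "(int \<Rightarrow> int) set" where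
  "Omega = {\<omega>. \<forall>n. \<omega> n = 1 \<or> \<omega> n = -1}"

definition Omega_borel :: "(int \<Rightarrow> int) measure" where
  "Omega_borel = restrict_space borel Omega"

definition shift :: "(int \<Rightarrow> int) \<Rightarrow> int \<Rightarrow> int" where
  "shift \<omega> = (\<lambda>n. \<omega> (n + 1))"

definition shift_pow :: "int \<Rightarrow> (int \<Rightarrow> int) \<Rightarrow> int \<Rightarrow> int" where
  "shift_pow k = (if 0 \<le> k then shift ^^ nat k else inv shift ^^ nat (- k))"

definition N_dirs :: "(int \<times> int) set" where
  "N_dirs = {(1, 0), (0, 1), (-1, 0), (0, -1)}"

definition mu_N :: "(int \<times> int) measure" where
  "mu_N = uniform_count_measure N_dirs"

type_synonym state = "(int \<Rightarrow> int) \<times> (int \<Rightarrow> int) \<times> (int \<times> int)"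

definition X_space :: "state set" where
  "X_space = Omega \<times> Omega \<times> N_dirs"

definition Phi :: "state \<Rightarrow> state" where
  "Phi = (\<lambda>(\<omega>, \<omega>', (a, b)).
     let s = \<omega> 0 * \<omega>' 0
     in (shift_pow (s * b) \<omega>, shift_pow (s * a) \<omega>', (s * b, s * a)))"

definition has_stable_periodic_orbit :: "state \<Rightarrow> bool" where
  "has_stable_periodic_orbit = (\<lambda>(\<omega>, \<omega>', v).
     \<exists>n\<ge>1. \<exists>U U'. openin (top_of_set Omega) U \<and> \<omega> \<in> U \<and>
       openin (top_of_set Omega) U' \<and> \<omega>' \<in> U' \<and>
       (\<forall>\<eta>\<in>U. \<forall>\<eta>'\<in>U'. (Phi ^^ n) (\<eta>, \<eta>', v) = (\<eta>, \<eta>', v)))"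

definition invariant_measures :: "(int \<Rightarrow> int) measure set" where
  "invariant_measures =
     {\<mu>. sets \<mu> = sets Omega_borel \<and> prob_space \<mu> \<and> distr \<mu> Omega_borel shift = \<mu>}"

definition ergodic_measures :: "(int \<Rightarrow> int) measure set" where
  "ergodic_measures =
     {\<nu> \<in> invariant_measures. \<forall>A\<in>sets Omega_borel.
        shift -` A \<inter> Omega = A \<longrightarrow> measure \<nu> A = 0 \<or> measure \<nu> A = 1}"

text \<open>The \<open>\<sigma>\<close>-algebra on the space of invariant measures is generated by the evaluations
  \<open>\<nu> \<mapsto> \<nu> A\<close>; as \<open>Omega\<close> is compact and metrizable, it is the Borel \<open>\<sigma>\<close>-algebra of the
  weak-* topology.  No measurability of \<open>ergodic_measures\<close> is presupposed below: a set of
  \<open>emeasure\<close> 1 is measurable.\<close>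

definition is_ergodic_decomposition ::
  "(int \<Rightarrow> int) measure \<Rightarrow> (int \<Rightarrow> int) measure measure \<Rightarrow> bool" where
  "is_ergodic_decomposition \<mu> \<Lambda> \<longleftrightarrow>
     sets \<Lambda> = sets (restrict_space (prob_algebra Omega_borel) invariant_measures) \<and>
     prob_space \<Lambda> \<and>
     emeasure \<Lambda> ergodic_measures = 1 \<and>
     (\<forall>f :: (int \<Rightarrow> int) \<Rightarrow> real. continuous_on Omega f \<longrightarrow>
        (LINT \<omega>|\<mu>. f \<omega>) = (LINT \<nu>:ergodic_measures|\<Lambda>. (LINT \<omega>|\<nu>. f \<omega>)))"

lemma shift_pow_apply: "shift_pow k \<omega> n = \<omega> (n + k)"
proof -
  have pos: "(shift ^^ m) \<omega> = (\<lambda>n. \<omega> (n + int m))" for m \<omega>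
    by (induction m) (auto simp: shift_def algebra_simps)
  have "inv shift = (\<lambda>\<omega> n. \<omega> (n - 1))"
    by (rule inv_equality) (auto simp: shift_def)
  then have "(inv shift ^^ m) \<omega> = (\<lambda>n. \<omega> (n - int m))" for m \<omega>
    by (induction m) (auto simp: algebra_simps)
  with pos show ?thesis
    by (simp add: shift_pow_def)
qed

lemma Phi_in_X_space: "p \<in> X_space \<Longrightarrow> Phi p \<in> X_space"
proof -
  assume "p \<in> X_space"
  then obtain \<omega> \<omega>' a b where p: "p = (\<omega>, \<omega>', a, b)" "\<omega> \<in> Omega" "\<omega>' \<in> Omega" "(a, b) \<in> N_dirs"
    by (auto simp: X_space_def)
  define s where "s = \<omega> 0 * \<omega>' 0"
  have "s = 1 \<or> s = -1"
  proof -
    have "\<omega> 0 = 1 \<or> \<omega> 0 = -1" "\<omega>' 0 = 1 \<or> \<omega>' 0 = -1"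
      using p(2,3) by (simp_all add: Omega_def)
    then show ?thesis
      unfolding s_def by (elim disjE) simp_all
  qed
  then have "(s * b, s * a) \<in> N_dirs"
    using p(4) by (auto simp: N_dirs_def)
  moreover have "Phi p = (shift_pow (s * b) \<omega>, shift_pow (s * a) \<omega>', (s * b, s * a))"
    by (simp add: Phi_def p(1) s_def Let_def)
  ultimately show ?thesis
    using p(2,3) by (auto simp: X_space_def Omega_def shift_pow_apply)
qed

lemma no_stable_periodic_orbit_measurable:
  assumes "sets \<mu> = sets Omega_borel" "sets \<mu>' = sets Omega_borel"
  shows "{p \<in> X_space. \<not> has_stable_periodic_orbit p} \<in> sets (\<mu> \<Otimes>\<^sub>M \<mu>' \<Otimes>\<^sub>M mu_N)"
proof -
  let ?M = "Omega_borel \<Otimes>\<^sub>M Omega_borel \<Otimes>\<^sub>M mu_N"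
  have eq: "sets (\<mu> \<Otimes>\<^sub>M \<mu>' \<Otimes>\<^sub>M mu_N) = sets ?M"
    using assms by (intro sets_pair_measure_cong refl) auto
  have sp: "space Omega_borel = Omega" "space mu_N = N_dirs"
    by (simp_all add: Omega_borel_def mu_N_def space_restrict_space space_uniform_count_measure)
  have spM: "space ?M = X_space"
    by (simp add: space_pair_measure sp X_space_def)
  define W where "W v = \<Union>{T \<times> T' | T T'. open T \<and> open T' \<and>
     (\<exists>n\<ge>1. \<forall>\<eta>\<in>Omega \<inter> T. \<forall>\<eta>'\<in>Omega \<inter> T'. (Phi ^^ n) (\<eta>, \<eta>', v) = (\<eta>, \<eta>', v))}" for v
  have W: "open (W v)" for v
    unfolding W_def by (intro open_Union) (auto intro: open_Times)
  have st: "has_stable_periodic_orbit (\<omega>, \<omega>', v) \<longleftrightarrow> (\<omega>, \<omega>') \<in> W v"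
    if "\<omega> \<in> Omega" "\<omega>' \<in> Omega" for \<omega> \<omega>' v
  proof
    assume "has_stable_periodic_orbit (\<omega>, \<omega>', v)"
    then obtain T T' n where "open T" "\<omega> \<in> T" "open T'" "\<omega>' \<in> T'" "n \<ge> 1"
      "\<forall>\<eta>\<in>Omega \<inter> T. \<forall>\<eta>'\<in>Omega \<inter> T'. (Phi ^^ n) (\<eta>, \<eta>', v) = (\<eta>, \<eta>', v)"
      unfolding has_stable_periodic_orbit_def openin_open prod.case by blast
    then show "(\<omega>, \<omega>') \<in> W v"
      unfolding W_def by blast
  next
    assume "(\<omega>, \<omega>') \<in> W v"
    then obtain T T' n where "\<omega> \<in> T" "\<omega>' \<in> T'" "open T" "open T'" "n \<ge> 1"
      "\<forall>\<eta>\<in>Omega \<inter> T. \<forall>\<eta>'\<in>Omega \<inter> T'. (Phi ^^ n) (\<eta>, \<eta>', v) = (\<eta>, \<eta>', v)"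
      unfolding W_def by blast
    with that show "has_stable_periodic_orbit (\<omega>, \<omega>', v)"
      unfolding has_stable_periodic_orbit_def openin_open prod.case
      by (intro exI[of _ n] exI[of _ "Omega \<inter> T"] exI[of _ "Omega \<inter> T'"]) blast
  qed
  have emb: "(\<lambda>\<omega>. \<omega>) \<in> measurable Omega_borel borel"
    unfolding Omega_borel_def by (rule measurable_restrict_space1) simp
  have "(\<lambda>p. (fst p, fst (snd p))) \<in> measurable ?M (borel \<Otimes>\<^sub>M borel)"
    by (intro measurable_Pair measurable_compose[OF measurable_fst emb]
        measurable_compose[OF measurable_compose[OF measurable_snd measurable_fst] emb])
  then have proj: "(\<lambda>p. (fst p, fst (snd p))) \<in> borel_measurable ?M"
    by (simp add: borel_prod)
  have v: "(\<lambda>p. snd (snd p)) \<in> measurable ?M (count_space N_dirs)"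
  proof -
    have "(\<lambda>p. snd (snd p)) \<in> measurable ?M mu_N"
      by (rule measurable_compose[OF measurable_snd measurable_snd])
    moreover have "sets mu_N = sets (count_space N_dirs)"
      by (simp add: mu_N_def sets_uniform_count_measure)
    ultimately show ?thesis
      using measurable_cong_sets by blast
  qed
  have "{p \<in> X_space. has_stable_periodic_orbit p} =
      (\<Union>v\<in>N_dirs. ((\<lambda>p. (fst p, fst (snd p))) -` W v \<inter> space ?M) \<inter> ((\<lambda>p. snd (snd p)) -` {v} \<inter> space ?M))"
    unfolding spM by (auto simp: X_space_def st)
  also have "\<dots> \<in> sets ?M"
    using W by (intro sets.finite_UN sets.Int measurable_sets[OF proj] measurable_sets[OF v])
      (auto simp: N_dirs_def)
  finally have "space ?M - {p \<in> X_space. has_stable_periodic_orbit p} \<in> sets ?M"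
    by auto
  also have "space ?M - {p \<in> X_space. has_stable_periodic_orbit p} = {p \<in> X_space. \<not> has_stable_periodic_orbit p}"
    unfolding spM by auto
  finally show ?thesis
    unfolding eq .
qed

end

theory Submission
  imports Defs
begin

text \<open>Read \<open>Phi\<close> as a walk on the square lattice in which \<open>\<omega>\<close> belongs to the columns and \<open>\<omega>'\<close> to
  the rows.  Horizontal and vertical steps alternate, and up to one global sign a step in column
  \<open>x\<close> goes in direction \<open>\<omega> x\<close> and a step in row \<open>y\<close> in direction \<open>\<omega>' y\<close>.  Stable periodicity
  forces the walk to close up, so after crossing a fixed horizontal line it must cross that line
  again, in the opposite direction.  Fix a typical \<open>\<omega>'\<close>.  Sending a crossing to the next one is
  then a shift-equivariant injection \<open>x \<mapsto> z\<close> of the columns with \<open>\<omega> z = - \<omega> x\<close>, and mass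
  transport gives \<open>\<nu> {\<omega> 0 = 1} = \<nu> {\<omega> 0 = -1}\<close> for every invariant \<open>\<nu>\<close> for which almost all
  \<open>\<omega>\<close> have this recurrence.  Almost all ergodic components are such \<open>\<nu>\<close>.  The second claim
  follows by exchanging the two coordinates.\<close>

section \<open>The walk\<close>

text \<open>One vertical step followed by one horizontal step, that is two applications of \<open>Phi\<close>, with
  the global sign normalised to \<open>1\<close>.\<close>

definition corner_step :: "(int \<Rightarrow> int) \<Rightarrow> (int \<Rightarrow> int) \<Rightarrow> int \<times> int \<Rightarrow> int \<times> int" where
  "corner_step \<omega> \<omega>' = (\<lambda>(x, y). (x + \<omega>' (y + \<omega> x), y + \<omega> x))"

lemma OmegaD: "\<omega> \<in> Omega \<Longrightarrow> \<omega> n = 1 \<or> \<omega> n = -1"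
  by (simp add: Omega_def)

lemma shift_pow_shift_pow: "shift_pow k (shift_pow l \<omega>) = shift_pow (k + l) \<omega>"
  by (rule ext) (simp add: shift_pow_apply algebra_simps)

lemma shift_pow_0 [simp]: "shift_pow 0 \<omega> = \<omega>"
  by (rule ext) (simp add: shift_pow_apply)

lemma shift_pow_in_Omega [simp]: "shift_pow k \<omega> \<in> Omega \<longleftrightarrow> \<omega> \<in> Omega"
proof
  assume "shift_pow k \<omega> \<in> Omega"
  then have "shift_pow k \<omega> (n - k) = 1 \<or> shift_pow k \<omega> (n - k) = -1" for n
    by (rule OmegaD)
  then show "\<omega> \<in> Omega"
    by (simp add: Omega_def shift_pow_apply)
qed (simp add: Omega_def shift_pow_apply)

text \<open>The walk can be run backwards: the arrival row determines the horizontal step, hence the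
  old column, and that column determines the vertical step.\<close>

lemma inj_corner_step: "inj (corner_step \<omega> \<omega>')"
  by (auto simp: inj_on_def corner_step_def)

text \<open>With the walk at \<open>(x, y)\<close>, the sequences are recentred there and the
  velocity is \<open>(\<omega>' y, 0)\<close>. The first factor \<open>s\<close> squares away
  \<open>\<omega>' y\<close> and leaves the vertical step \<open>\<omega> x\<close>; the second
  squares away \<open>\<omega> x\<close> and leaves the sign of the new row, so this form of state
  is preserved.\<close>

lemma Phi_Phi_corner_step:
  assumes "\<omega> \<in> Omega" "\<omega>' \<in> Omega" and c: "corner_step \<omega> \<omega>' (x, y) = (x1, y1)"
  shows "Phi (Phi (shift_pow x \<omega>, shift_pow y \<omega>', (\<omega>' y, 0))) =
    (shift_pow x1 \<omega>, shift_pow y1 \<omega>', (\<omega>' y1, 0))"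
proof -
  have sq: "\<omega> n * \<omega> n = 1" "\<omega>' n * \<omega>' n = 1" for n
    using OmegaD[OF assms(1), of n] OmegaD[OF assms(2), of n] by auto
  have sq': "\<omega> n * (\<omega> n * m) = m" "\<omega>' n * (\<omega>' n * m) = m" for n m
    by (simp_all add: sq flip: mult.assoc)
  have xy: "y1 = y + \<omega> x" "x1 = x + \<omega>' y1"
    using c by (auto simp: corner_step_def)
  have "Phi (shift_pow x \<omega>, shift_pow y \<omega>', (\<omega>' y, 0)) =
      (shift_pow x \<omega>, shift_pow y1 \<omega>', (0, \<omega> x))"
    by (simp add: Phi_def Let_def shift_pow_apply shift_pow_shift_pow xy sq sq' mult.assoc add.commute)
  also have "Phi \<dots> = (shift_pow x1 \<omega>, shift_pow y1 \<omega>', (\<omega>' y1, 0))"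
    by (simp add: Phi_def Let_def shift_pow_apply shift_pow_shift_pow xy(2) sq sq' ac_simps)
  finally show ?thesis .
qed

lemma Phi_iterate_corner_step:
  assumes "\<omega> \<in> Omega" "\<omega>' \<in> Omega" and "(corner_step \<omega> \<omega>' ^^ n) (x, y) = (x1, y1)"
  shows "(Phi ^^ (2 * n)) (shift_pow x \<omega>, shift_pow y \<omega>', (\<omega>' y, 0)) =
    (shift_pow x1 \<omega>, shift_pow y1 \<omega>', (\<omega>' y1, 0))"
  using assms(3)
proof (induction n arbitrary: x1 y1)
  case (Suc n)
  obtain x2 y2 where e: "(corner_step \<omega> \<omega>' ^^ n) (x, y) = (x2, y2)"
    by fastforce
  then have "corner_step \<omega> \<omega>' (x2, y2) = (x1, y1)"
    using Suc.prems by simp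
  with Suc.IH[OF e] Phi_Phi_corner_step[OF assms(1,2)] show ?case
    by simp
qed simp

lemma corner_step_translate:
  "(corner_step (shift_pow k \<omega>) (shift_pow l \<omega>') ^^ n) (x, y) =
     (fst ((corner_step \<omega> \<omega>' ^^ n) (x + k, y + l)) - k, snd ((corner_step \<omega> \<omega>' ^^ n) (x + k, y + l)) - l)"
proof (induction n)
  case (Suc n)
  then show ?case
    by (simp add: corner_step_def shift_pow_apply algebra_simps split: prod.splits)
qed simp

lemma corner_step_row_bound:
  assumes "\<omega> \<in> Omega"
  shows "\<bar>snd ((corner_step \<omega> \<omega>' ^^ n) (x, y)) - y\<bar> \<le> int n"
proof (induction n)
  case (Suc n)
  obtain x2 y2 where "(corner_step \<omega> \<omega>' ^^ n) (x, y) = (x2, y2)"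
    by fastforce
  with Suc OmegaD[OF assms, of x2] show ?case
    by (auto simp: corner_step_def)
qed simp

lemma corner_step_local:
  assumes "\<omega> \<in> Omega" and "\<And>k. \<bar>k - y\<bar> \<le> int n \<Longrightarrow> \<beta> k = \<omega>' k"
  shows "(corner_step \<omega> \<beta> ^^ n) (x, y) = (corner_step \<omega> \<omega>' ^^ n) (x, y)"
  using assms(2)
proof (induction n)
  case (Suc n)
  obtain x2 y2 where e: "(corner_step \<omega> \<omega>' ^^ n) (x, y) = (x2, y2)"
    by fastforce
  \<comment> \<open>The horizontal half of the last step reads the row just entered, so agreement is
    required up to distance \<open>Suc n\<close>, the last row included.\<close>
  have "\<bar>y2 + \<omega> x2 - y\<bar> \<le> int (Suc n)"
    using corner_step_row_bound[OF assms(1), where \<omega>'=\<omega>' and n="Suc n" and x=x and y=y] e by (simp add: corner_step_def)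
  with Suc e show ?case
    by (simp add: corner_step_def)
qed simp

text \<open>If the walk came back displaced vertically by \<open>k \<noteq> 0\<close>, then all vertical sequences near
  \<open>\<omega>'\<close> would be \<open>k\<close>-periodic; changing a single far away entry refutes this.\<close>

lemma stable_imp_row_recurrent:
  assumes \<omega>: "\<omega> \<in> Omega" and \<omega>': "\<omega>' \<in> Omega"
    and st: "has_stable_periodic_orbit (shift_pow x \<omega>, shift_pow y \<omega>', (\<omega>' y, 0))"
  shows "\<exists>n>0. snd ((corner_step \<omega> \<omega>' ^^ n) (x, y)) = y"
proof -
  define \<alpha> where "\<alpha> = shift_pow x \<omega>"
  define \<beta> where "\<beta> = shift_pow y \<omega>'"
  have \<alpha>: "\<alpha> \<in> Omega" and \<beta>: "\<beta> \<in> Omega"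
    using \<omega> \<omega>' by (simp_all add: \<alpha>_def \<beta>_def)
  have v: "\<omega>' y = \<beta> 0"
    by (simp add: \<beta>_def shift_pow_apply)
  obtain n U U' where n: "n \<ge> 1" and U: "openin (top_of_set Omega) U" "\<alpha> \<in> U"
    and U': "openin (top_of_set Omega) U'" "\<beta> \<in> U'"
    and per: "\<And>\<eta> \<eta>'. \<eta> \<in> U \<Longrightarrow> \<eta>' \<in> U' \<Longrightarrow> (Phi ^^ n) (\<eta>, \<eta>', (\<beta> 0, 0)) = (\<eta>, \<eta>', (\<beta> 0, 0))"
    using st unfolding has_stable_periodic_orbit_def prod.case v \<alpha>_def[symmetric] \<beta>_def[symmetric] by blast
  obtain V where V: "open V" "U' = Omega \<inter> V"
    using U'(1) unfolding openin_open by blast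
  \<comment> \<open>A basic neighbourhood of \<open>\<beta>\<close> constrains only finitely many
    coordinates.\<close>
  obtain W where W: "\<beta> \<in> Pi\<^sub>E UNIV W" "finite {i. W i \<noteq> UNIV}" "Pi\<^sub>E UNIV W \<subseteq> V"
    using product_topology_open_contains_basis[of "\<lambda>_. euclidean" UNIV V \<beta>] V U'(2)
    by (auto simp: open_fun_def)
  \<comment> \<open>Entry \<open>j\<close> is unconstrained, so flipping it stays in
    \<open>U'\<close>. It also lies beyond distance \<open>n\<close>, so \<open>n\<close> corner
    steps from the origin do not see the flip, and entry \<open>0\<close>, which fixes the initial
    velocity, is unchanged.\<close>
  obtain j where j: "j \<notin> {i. W i \<noteq> UNIV} \<union> {- int n..int n}"
    using ex_new_if_finite[OF infinite_UNIV_int, of "{i. W i \<noteq> UNIV} \<union> {- int n..int n}"] W(2) by auto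
  define \<gamma> where "\<gamma> = \<beta>(j := - \<beta> j)"
  have \<gamma>: "\<gamma> \<in> Omega"
    using \<beta> by (auto simp: Omega_def \<gamma>_def)
  have "\<gamma> \<in> Pi\<^sub>E UNIV W"
    using W(1) j by (auto simp: \<gamma>_def PiE_iff)
  then have \<gamma>U: "\<gamma> \<in> U'"
    using W(3) V \<gamma> by auto
  obtain x1 y1 where e: "(corner_step \<alpha> \<beta> ^^ n) (0, 0) = (x1, y1)"
    by fastforce
  have e': "(corner_step \<alpha> \<gamma> ^^ n) (0, 0) = (x1, y1)"
    using corner_step_local[OF \<alpha>, where y=0 and n=n and \<beta>=\<gamma> and \<omega>'=\<beta> and x=0] j e by (auto simp: \<gamma>_def)
  \<comment> \<open>The period \<open>n\<close> may be odd while a corner step takes two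
    applications of \<open>Phi\<close>; the multiple \<open>2 * n\<close> amounts to
    \<open>n\<close> corner steps.\<close>
  have per2: "(Phi ^^ (2 * n)) (\<alpha>, \<eta>', (\<beta> 0, 0)) = (\<alpha>, \<eta>', (\<beta> 0, 0))" if "\<eta>' \<in> U'" for \<eta>'
    using per[OF U(2) that] by (simp add: mult_2 funpow_add)
  have \<gamma>0: "\<gamma> 0 = \<beta> 0"
    using j by (auto simp: \<gamma>_def)
  have "shift_pow y1 \<beta> = \<beta>"
    using per2[OF U'(2)] Phi_iterate_corner_step[OF \<alpha> \<beta> e] by simp
  then have b: "\<beta> (j + y1) = \<beta> j"
    by (metis shift_pow_apply)
  have "shift_pow y1 \<gamma> = \<gamma>"
    using per2[OF \<gamma>U] Phi_iterate_corner_step[OF \<alpha> \<gamma> e'] \<gamma>0 by simp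
  then have g: "\<gamma> (j + y1) = \<gamma> j"
    by (metis shift_pow_apply)
  \<comment> \<open>Otherwise \<open>\<gamma> (j + y1) = \<beta> (j + y1) = \<beta> j\<close>,
    whereas \<open>\<gamma> j = - \<beta> j\<close> and \<open>\<beta> j\<close> is nonzero.\<close>
  have "y1 = 0"
    using b g OmegaD[OF \<beta>, of j] by (auto simp: \<gamma>_def split: if_splits)
  then have "snd ((corner_step \<omega> \<omega>' ^^ n) (x, y)) = y"
    using e corner_step_translate[where k=x and \<omega>=\<omega> and l=y and \<omega>'=\<omega>' and n=n and x=0 and y=0] by (simp add: \<alpha>_def \<beta>_def)
  with n show ?thesis
    by (intro exI[of _ n]) auto
qed

section \<open>Symmetry between columns and rows\<close>

definition swap_state :: "state \<Rightarrow> state" where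
  "swap_state = (\<lambda>(\<omega>, \<omega>', (a, b)). (\<omega>', \<omega>, (b, a)))"

text \<open>The swap reflects the lattice in its diagonal; it commutes with \<open>Phi\<close>
  because \<open>s\<close> is symmetric in the two sequences.\<close>

lemma Phi_iterate_swap: "(Phi ^^ n) (swap_state p) = swap_state ((Phi ^^ n) p)"
proof (induction n)
  case (Suc n)
  have "Phi (swap_state q) = swap_state (Phi q)" for q
    by (cases q) (auto simp: Phi_def swap_state_def Let_def mult.commute)
  with Suc show ?case
    by simp
qed simp

lemma has_stable_periodic_orbit_swap:
  assumes "has_stable_periodic_orbit (\<omega>, \<omega>', (a, b))"
  shows "has_stable_periodic_orbit (\<omega>', \<omega>, (b, a))"
proof -
  obtain n U U' where "n \<ge> 1" "openin (top_of_set Omega) U" "\<omega> \<in> U"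
    "openin (top_of_set Omega) U'" "\<omega>' \<in> U'"
    and per: "\<forall>\<eta>\<in>U. \<forall>\<eta>'\<in>U'. (Phi ^^ n) (\<eta>, \<eta>', (a, b)) = (\<eta>, \<eta>', (a, b))"
    using assms unfolding has_stable_periodic_orbit_def prod.case by blast
  moreover have "\<forall>\<eta>'\<in>U'. \<forall>\<eta>\<in>U. (Phi ^^ n) (\<eta>', \<eta>, (b, a)) = (\<eta>', \<eta>, (b, a))"
    using per Phi_iterate_swap[of n "(_, _, (a, b))"] by (simp add: swap_state_def)
  ultimately show ?thesis
    unfolding has_stable_periodic_orbit_def prod.case by blast
qed

section \<open>Crossings of a horizontal line\<close>

text \<open>The point of column \<open>x\<close> from which the walk crosses the line between the rows \<open>0\<close> and \<open>1\<close>: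
  upwards if \<open>\<omega> x = 1\<close> and downwards if \<open>\<omega> x = -1\<close>.\<close>

definition crossing :: "(int \<Rightarrow> int) \<Rightarrow> int \<Rightarrow> int \<times> int" where
  "crossing \<omega> x = (x, if \<omega> x = 1 then 0 else 1)"

text \<open>The first return of the walk to the set of crossings, as a relation because a return may
  fail to occur.\<close>

definition next_crossing :: "(int \<Rightarrow> int) \<Rightarrow> (int \<Rightarrow> int) \<Rightarrow> int \<Rightarrow> nat \<Rightarrow> int \<Rightarrow> bool" where
  "next_crossing \<omega>' \<omega> x n z \<longleftrightarrow> 0 < n \<and> (corner_step \<omega> \<omega>' ^^ n) (crossing \<omega> x) = crossing \<omega> z \<and>
     (\<forall>k. 0 < k \<longrightarrow> k < n \<longrightarrow> (corner_step \<omega> \<omega>' ^^ k) (crossing \<omega> x) \<notin> range (crossing \<omega>))"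

lemma crossing_eq_iff [simp]: "crossing \<omega> x = crossing \<omega> z \<longleftrightarrow> x = z"
  by (auto simp: crossing_def)

lemma next_crossing_right_unique:
  assumes "next_crossing \<omega>' \<omega> x n z" "next_crossing \<omega>' \<omega> x m w"
  shows "n = m \<and> z = w"
proof -
  have "n = m"
    using assms unfolding next_crossing_def by (metis linorder_neqE_nat rangeI)
  with assms show ?thesis
    by (auto simp: next_crossing_def)
qed

text \<open>Cancelling the last \<open>n\<close> steps by injectivity puts the crossing at
  \<open>x\<close> on the path from \<open>w\<close> at time \<open>m - n < m\<close>. A positive
  time would contradict that \<open>m\<close> is the first return time.\<close>

lemma next_crossing_left_unique_aux:
  assumes "next_crossing \<omega>' \<omega> x n z" "next_crossing \<omega>' \<omega> w m z" "n \<le> m"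
  shows "n = m \<and> x = w"
proof -
  let ?T = "corner_step \<omega> \<omega>'"
  have "(?T ^^ n) (crossing \<omega> x) = (?T ^^ n) ((?T ^^ (m - n)) (crossing \<omega> w))"
    using assms funpow_add[of n "m - n" ?T] by (simp add: next_crossing_def)
  moreover have "inj (?T ^^ n)"
    by (simp add: inj_corner_step)
  ultimately have e: "crossing \<omega> x = (?T ^^ (m - n)) (crossing \<omega> w)"
    by (simp add: inj_eq)
  have "\<not> 0 < m - n"
    using assms(1,2) e unfolding next_crossing_def
    by (metis diff_less rangeI)
  with e assms(3) show ?thesis
    by simp
qed

lemma next_crossing_left_unique:
  assumes "next_crossing \<omega>' \<omega> x n z" "next_crossing \<omega>' \<omega> w m z"
  shows "n = m \<and> x = w"
  using next_crossing_left_unique_aux assms by (metis nle_le)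

text \<open>Horizontal translation keeps the rows, hence \<open>\<omega>'\<close> and the line being
  crossed, so it conjugates the walks and maps crossings to crossings.\<close>

lemma next_crossing_translate:
  "next_crossing \<omega>' (shift_pow r \<omega>) x n z \<longleftrightarrow> next_crossing \<omega>' \<omega> (x + r) n (z + r)"
proof -
  define \<tau> :: "int \<times> int \<Rightarrow> int \<times> int" where "\<tau> = (\<lambda>(x, y). (x - r, y))"
  have cr: "crossing (shift_pow r \<omega>) x = \<tau> (crossing \<omega> (x + r))" for x
    by (simp add: crossing_def shift_pow_apply \<tau>_def)
  have it: "(corner_step (shift_pow r \<omega>) \<omega>' ^^ k) (\<tau> p) = \<tau> ((corner_step \<omega> \<omega>' ^^ k) p)" for k p
    using corner_step_translate[where k=r and \<omega>=\<omega> and l=0 and \<omega>'=\<omega>' and n=k and x="fst p - r" and y="snd p"]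
    by (simp add: \<tau>_def split_beta)
  have inj: "\<tau> p = \<tau> q \<longleftrightarrow> p = q" for p q
    by (auto simp: \<tau>_def split: prod.splits)
  have "range (crossing (shift_pow r \<omega>)) = \<tau> ` range (crossing \<omega>)"
  proof -
    have "\<tau> (crossing \<omega> x) = crossing (shift_pow r \<omega>) (x - r)" for x
      by (simp add: cr)
    then have "\<tau> ` range (crossing \<omega>) \<subseteq> range (crossing (shift_pow r \<omega>))"
      by (metis image_subsetI imageE rangeI)
    moreover have "range (crossing (shift_pow r \<omega>)) \<subseteq> \<tau> ` range (crossing \<omega>)"
      by (simp add: cr image_subset_iff)
    ultimately show ?thesis
      by (rule antisym[rotated])
  qed
  then have rg: "\<tau> p \<in> range (crossing (shift_pow r \<omega>)) \<longleftrightarrow> p \<in> range (crossing \<omega>)" for p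
    by (simp add: inj inj_image_mem_iff inj_def)
  show ?thesis
    unfolding next_crossing_def cr it inj rg ..
qed

text \<open>The row changes by one unit per corner step, so the side of the line changes only
  upwards from row \<open>0\<close> or downwards from row \<open>1\<close>.\<close>

lemma in_range_crossing_iff:
  assumes "\<omega> \<in> Omega"
  shows "p \<in> range (crossing \<omega>) \<longleftrightarrow> (snd (corner_step \<omega> \<omega>' p) \<ge> 1) \<noteq> (snd p \<ge> 1)"
proof -
  obtain x y where p: "p = (x, y)"
    by fastforce
  have "p \<in> range (crossing \<omega>) \<longleftrightarrow> y = (if \<omega> x = 1 then 0 else 1)"
    by (auto simp: crossing_def p)
  with OmegaD[OF assms, of x] show ?thesis
    by (auto simp: corner_step_def p)
qed

lemma crossing_direction:
  assumes "\<omega> \<in> Omega"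
  shows "snd (crossing \<omega> x) \<ge> 1 \<longleftrightarrow> \<omega> x = -1"
    "snd (corner_step \<omega> \<omega>' (crossing \<omega> x)) \<ge> 1 \<longleftrightarrow> \<omega> x = 1"
  using OmegaD[OF assms, of x] by (auto simp: crossing_def corner_step_def)

text \<open>The side changes only at crossings. The comparison is with the position after one step,
  since \<open>p\<close> itself may be a crossing.\<close>

lemma same_side_until_next_crossing:
  assumes "\<omega> \<in> Omega" "0 < n"
    and "\<And>k. 0 < k \<Longrightarrow> k < n \<Longrightarrow> (corner_step \<omega> \<omega>' ^^ k) p \<notin> range (crossing \<omega>)"
  shows "snd ((corner_step \<omega> \<omega>' ^^ n) p) \<ge> 1 \<longleftrightarrow> snd (corner_step \<omega> \<omega>' p) \<ge> 1"
  using assms(2,3)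
proof (induction n)
  case (Suc n)
  show ?case
  proof (cases "n = 0")
    case False
    then have "(corner_step \<omega> \<omega>' ^^ n) p \<notin> range (crossing \<omega>)"
      using Suc.prems by simp
    then show ?thesis
      using Suc False in_range_crossing_iff[OF assms(1), of "(corner_step \<omega> \<omega>' ^^ n) p" \<omega>'] by auto
  qed simp
qed simp

text \<open>The crossing at \<open>x\<close> ends on the side from which the crossing at
  \<open>z\<close> starts, so the two go in opposite directions.\<close>

lemma next_crossing_opposite:
  assumes "\<omega> \<in> Omega" "next_crossing \<omega>' \<omega> x n z"
  shows "\<omega> z = - \<omega> x"
proof -
  have "snd (crossing \<omega> z) \<ge> 1 \<longleftrightarrow> snd (corner_step \<omega> \<omega>' (crossing \<omega> x)) \<ge> 1"
    using same_side_until_next_crossing[OF assms(1), of n \<omega>' "crossing \<omega> x"] assms(2)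
    by (auto simp: next_crossing_def)
  with crossing_direction[OF assms(1)] OmegaD[OF assms(1), of x] OmegaD[OF assms(1), of z]
  show ?thesis
    by (smt (verit))
qed

definition row_recurrent :: "(int \<Rightarrow> int) \<Rightarrow> (int \<Rightarrow> int) \<Rightarrow> bool" where
  "row_recurrent \<omega>' \<omega> \<longleftrightarrow> (\<forall>x y. \<exists>n>0. snd ((corner_step \<omega> \<omega>' ^^ n) (x, y)) = y)"

text \<open>The first step leaves the starting side and a return to the starting row comes back to
  it, so the line is crossed again in between.\<close>

lemma next_crossing_exists:
  assumes "\<omega> \<in> Omega" "row_recurrent \<omega>' \<omega>"
  shows "\<exists>n z. next_crossing \<omega>' \<omega> x n z"
proof -
  let ?T = "corner_step \<omega> \<omega>'" and ?p = "crossing \<omega> x"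
  obtain N where N: "0 < N" "snd ((?T ^^ N) ?p) = snd ?p"
    using assms(2) unfolding row_recurrent_def by (metis prod.collapse)
  have "\<exists>k. 0 < k \<and> (?T ^^ k) ?p \<in> range (crossing \<omega>)"
  proof (rule ccontr)
    assume "\<not> ?thesis"
    then have "snd ((?T ^^ N) ?p) \<ge> 1 \<longleftrightarrow> snd (?T ?p) \<ge> 1"
      using same_side_until_next_crossing[OF assms(1) N(1)] by blast
    with N crossing_direction[OF assms(1)] OmegaD[OF assms(1), of x] show False
      by auto
  qed
  then obtain n where "0 < n" "(?T ^^ n) ?p \<in> range (crossing \<omega>)"
    "\<And>k. 0 < k \<Longrightarrow> k < n \<Longrightarrow> (?T ^^ k) ?p \<notin> range (crossing \<omega>)"
    unfolding exists_least_iff[where P="\<lambda>k. 0 < k \<and> (?T ^^ k) ?p \<in> range (crossing \<omega>)"] by blast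
  then show ?thesis
    unfolding next_crossing_def by blast
qed

section \<open>Invariant measures\<close>

lemma space_Omega_borel [simp]: "space Omega_borel = Omega"
  by (simp add: Omega_borel_def space_restrict_space)

lemma measurable_coordinate: "(\<lambda>\<omega>. \<omega> i) \<in> measurable Omega_borel (count_space UNIV)"
proof -
  have "(\<lambda>\<omega>. \<omega> i) \<in> borel_measurable (borel :: (int \<Rightarrow> int) measure)"
    by (intro borel_measurable_continuous_onI continuous_on_product_coordinates)
  then have m: "(\<lambda>\<omega>. \<omega> i) \<in> borel_measurable Omega_borel"
    unfolding Omega_borel_def by (rule measurable_restrict_space1)
  show ?thesis
    unfolding measurable_count_space_eq_countable[OF countableI_type]
    using measurable_sets[OF m, of "{_}"] by auto
qed

lemma measurable_shift_pow: "shift_pow k \<in> measurable Omega_borel Omega_borel"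
proof -
  have "continuous_on UNIV (shift_pow k)"
    by (intro continuous_on_coordinatewise_then_product)
      (simp add: shift_pow_apply)
  then have "shift_pow k \<in> measurable borel borel"
    by (rule borel_measurable_continuous_onI)
  then show ?thesis
    unfolding Omega_borel_def
    by (intro measurable_restrict_space2 measurable_restrict_space1)
      (auto simp: space_restrict_space)
qed

lemma invariant_measuresD:
  assumes "\<nu> \<in> invariant_measures"
  shows "sets \<nu> = sets Omega_borel" "space \<nu> = Omega" "prob_space \<nu>"
  using assms sets_eq_imp_space_eq[of \<nu> Omega_borel] by (auto simp: invariant_measures_def)

lemma invariant_distr_shift_pow:
  assumes "\<nu> \<in> invariant_measures"
  shows "distr \<nu> Omega_borel (shift_pow k) = \<nu>"
proof -
  note inv = invariant_measuresD[OF assms]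
  have m: "shift_pow k \<in> measurable \<nu> Omega_borel" for k
    using measurable_shift_pow inv(1) measurable_cong_sets by blast
  have id: "distr \<nu> Omega_borel (shift_pow 0) = \<nu>"
    using distr_id2[OF inv(1)[symmetric]] by (simp cong: distr_cong)
  have comp: "distr (distr \<nu> Omega_borel (shift_pow l)) Omega_borel (shift_pow k)
      = distr \<nu> Omega_borel (shift_pow (k + l))" for k l
    by (simp add: distr_distr[OF measurable_shift_pow m] comp_def shift_pow_shift_pow cong: distr_cong)
  have sh: "shift = shift_pow 1"
    by (intro ext) (simp add: shift_pow_apply shift_def)
  have 1: "distr \<nu> Omega_borel (shift_pow 1) = \<nu>"
    using assms by (simp add: invariant_measures_def sh)
  \<comment> \<open>Pushing the invariance under \<open>shift\<close> forward by the inverse shift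
    yields invariance under the inverse.\<close>
  have m1: "distr \<nu> Omega_borel (shift_pow (-1)) = \<nu>"
    using comp[of 1 "-1"] comp[of "-1" 1] 1 id by simp
  show ?thesis
  proof (induction k rule: int_induct[where k=0])
    case base
    show ?case by (rule id)
  next
    case (step1 i)
    then show ?case using comp[of 1 i] 1 by (simp add: add.commute)
  next
    case (step2 i)
    then show ?case using comp[of "-1" i] m1 by simp
  qed
qed

lemma AE_shift_pow:
  assumes "\<nu> \<in> invariant_measures" "AE \<omega> in \<nu>. P \<omega>"
  shows "AE \<omega> in \<nu>. P (shift_pow k \<omega>)"
proof -
  have "AE \<omega> in distr \<nu> Omega_borel (shift_pow k). P \<omega>"
    unfolding invariant_distr_shift_pow[OF assms(1)] by (rule assms(2))
  then show ?thesis
    by (rule AE_distrD[rotated])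
      (metis measurable_shift_pow invariant_measuresD(1)[OF assms(1)] measurable_cong_sets)
qed

section \<open>Measurability of events of the walk\<close>

lemma measurable_corner_step:
  assumes "e \<in> measurable Omega_borel (count_space UNIV)"
  shows "(\<lambda>\<omega>. (corner_step \<omega> \<omega>' ^^ n) (e \<omega>)) \<in> measurable Omega_borel (count_space UNIV)"
proof (induction n)
  case (Suc n)
  have "(\<lambda>\<omega>. corner_step \<omega> \<omega>' p) \<in> measurable Omega_borel (count_space UNIV)" for p
    using measurable_compose[OF measurable_coordinate[of "fst p"],
        of "\<lambda>w. (fst p + \<omega>' (snd p + w), snd p + w)" "count_space UNIV"]
    by (simp add: corner_step_def split_beta)
  \<comment> \<open>The current position takes countably many values, and from a fixed position the
    next step depends on a single coordinate of \<omega>.\<close>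
  then show ?case
    using measurable_compose_countable[where f="\<lambda>p \<omega>. corner_step \<omega> \<omega>' p", OF _ Suc] by simp
qed (simp add: assms)

lemma measurable_crossing: "(\<lambda>\<omega>. crossing \<omega> x) \<in> measurable Omega_borel (count_space UNIV)"
  using measurable_compose[OF measurable_coordinate[of x], of "\<lambda>w. (x, if w = 1 then 0 else 1)" "count_space UNIV"]
  by (simp add: crossing_def)

lemma pred_row_recurrent: "Measurable.pred Omega_borel (row_recurrent \<omega>')"
proof -
  have [measurable]: "(\<lambda>\<omega>. (corner_step \<omega> \<omega>' ^^ n) (x, y)) \<in> measurable Omega_borel (count_space UNIV)" for n x y
    by (rule measurable_corner_step) simp
  show ?thesis
    unfolding row_recurrent_def by measurable
qed

lemma pred_next_crossing: "Measurable.pred Omega_borel (\<lambda>\<omega>. next_crossing \<omega>' \<omega> x n z)"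
proof -
  note [measurable] = measurable_crossing measurable_corner_step[OF measurable_crossing]
  have [measurable]: "Measurable.pred Omega_borel (\<lambda>\<omega>. f \<omega> = g \<omega>)"
    if [measurable]: "f \<in> measurable Omega_borel (count_space UNIV)" "g \<in> measurable Omega_borel (count_space UNIV)"
    for f g :: "_ \<Rightarrow> int \<times> int"
    by measurable
  show ?thesis
    unfolding next_crossing_def image_iff Bex_def by measurable
qed

text \<open>Mass transport: the next-crossing map is an equivariant injection of the columns that
  carries upward crossings to downward ones and conversely.\<close>

lemma invariant_emeasure_sign_le:
  assumes \<nu>: "\<nu> \<in> invariant_measures" and rec: "AE \<omega> in \<nu>. row_recurrent \<omega>' \<omega>"
  shows "emeasure \<nu> {\<omega> \<in> Omega. \<omega> 0 = \<epsilon>} \<le> emeasure \<nu> {\<omega> \<in> Omega. \<omega> 0 = - \<epsilon>}"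
proof -
  note inv = invariant_measuresD[OF \<nu>]
  \<comment> \<open>\<open>D (n, r)\<close> collects departures from column \<open>0\<close> that
    arrive at column \<open>r\<close> after time \<open>n\<close>; \<open>E (n, r)\<close> collects
    arrivals at column \<open>0\<close> from column \<open>-r\<close> after time
    \<open>n\<close>.\<close>
  define D where "D = (\<lambda>(n, r). {\<omega> \<in> Omega. \<omega> 0 = \<epsilon> \<and> next_crossing \<omega>' \<omega> 0 n r})"
  define E where "E = (\<lambda>(n, r). {\<omega> \<in> Omega. \<omega> (- r) = \<epsilon> \<and> next_crossing \<omega>' \<omega> (- r) n 0})"
  have sgn: "{\<omega> \<in> Omega. \<omega> x = c} \<in> sets \<nu>" for x c
    using measurable_sets[OF measurable_coordinate[of x], of "{c}"]
    by (simp add: inv(1) vimage_def Int_def conj_commute)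
  have nc: "{\<omega> \<in> Omega. \<omega> x = c \<and> next_crossing \<omega>' \<omega> x n z} \<in> sets \<nu>" for x c n z
  proof -
    have "{\<omega> \<in> Omega. next_crossing \<omega>' \<omega> x n z} \<in> sets \<nu>"
      using pred_next_crossing[of \<omega>' x n z] by (simp add: pred_def inv(1))
    from sets.Int[OF sgn[of x c] this] show ?thesis
      by (rule back_subst[of "\<lambda>A. A \<in> sets \<nu>"]) auto
  qed
  have DS: "D i \<in> sets \<nu>" and ES: "E i \<in> sets \<nu>" for i
    using nc by (auto simp: D_def E_def split: prod.split)
  have DE: "emeasure \<nu> (D i) = emeasure \<nu> (E i)" for i
  proof -
    obtain n r where i: "i = (n, r)"
      by fastforce
    have "emeasure \<nu> (D i) = emeasure (distr \<nu> Omega_borel (shift_pow (- r))) (D i)"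
      by (simp add: invariant_distr_shift_pow[OF \<nu>])
    also have "\<dots> = emeasure \<nu> (shift_pow (- r) -` D i \<inter> space \<nu>)"
      using DS[of i] measurable_shift_pow measurable_cong_sets[OF inv(1) refl]
      by (intro emeasure_distr) (auto simp: inv(1))
    \<comment> \<open>Shifting by \<open>-r\<close> turns the departure column \<open>0\<close> into
      \<open>-r\<close> and the arrival column \<open>r\<close> into \<open>0\<close>.\<close>
    also have "shift_pow (- r) -` D i \<inter> space \<nu> = E i"
      by (auto simp: D_def E_def i inv(2) next_crossing_translate shift_pow_apply)
    finally show ?thesis .
  qed
  have disjD: "disjoint_family_on D UNIV"
    unfolding disjoint_family_on_def D_def using next_crossing_right_unique by fastforce
  have disjE: "disjoint_family_on E UNIV"
  proof -
    have "i = j" if "\<omega> \<in> E i" "\<omega> \<in> E j" for i j \<omega>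
      using that next_crossing_left_unique[of \<omega>' \<omega> "- snd i" "fst i" 0 "- snd j" "fst j"]
      by (simp add: E_def split_beta prod_eq_iff)
    then show ?thesis
      by (auto simp: disjoint_family_on_def)
  qed
  have "emeasure \<nu> {\<omega> \<in> Omega. \<omega> 0 = \<epsilon>} = emeasure \<nu> (\<Union>i. D i)"
  proof (rule emeasure_eq_AE)
    \<comment> \<open>By recurrence almost every crossing at column \<open>0\<close> has a
      successor, so no mass is lost.\<close>
    show "AE \<omega> in \<nu>. \<omega> \<in> {\<omega> \<in> Omega. \<omega> 0 = \<epsilon>} \<longleftrightarrow> \<omega> \<in> (\<Union>i. D i)"
      using rec
    proof eventually_elim
      case (elim \<omega>)
      then show ?case
        using next_crossing_exists[of \<omega> \<omega>' 0] by (auto simp: D_def)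
    qed
  qed (use sgn DS in auto)
  also have "\<dots> = (\<integral>\<^sup>+i. emeasure \<nu> (D i) \<partial>count_space UNIV)"
    using DS by (intro emeasure_UN_countable disjD) auto
  also have "\<dots> = (\<integral>\<^sup>+i. emeasure \<nu> (E i) \<partial>count_space UNIV)"
    by (simp add: DE)
  also have "\<dots> = emeasure \<nu> (\<Union>i. E i)"
    using ES by (intro emeasure_UN_countable[symmetric] disjE) auto
  \<comment> \<open>Arrivals at column \<open>0\<close> have the sign opposite to that of their
    departure.\<close>
  also have "\<dots> \<le> emeasure \<nu> {\<omega> \<in> Omega. \<omega> 0 = - \<epsilon>}"
    using sgn next_crossing_opposite by (intro emeasure_mono) (auto simp: E_def)
  finally show ?thesis .
qed

lemma invariant_mean_zero:
  assumes \<nu>: "\<nu> \<in> invariant_measures" and rec: "AE \<omega> in \<nu>. row_recurrent \<omega>' \<omega>"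
  shows "(LINT \<omega>|\<nu>. real_of_int (\<omega> 0)) = 0"
proof -
  note inv = invariant_measuresD[OF \<nu>]
  interpret prob_space \<nu> by (rule inv(3))
  define A where "A c = {\<omega> \<in> Omega. \<omega> (0 :: int) = (c :: int)}" for c
  have A: "A c \<in> sets \<nu>" for c
    using measurable_sets[OF measurable_coordinate[of 0], of "{c}"]
    by (simp add: inv(1) vimage_def Int_def conj_commute A_def)
  have "emeasure \<nu> (A 1) = emeasure \<nu> (A (-1))"
    using invariant_emeasure_sign_le[OF assms, of 1] invariant_emeasure_sign_le[OF assms, of "-1"]
    by (simp add: A_def)
  then have eq: "measure \<nu> (A 1) = measure \<nu> (A (-1))"
    by (simp add: measure_def)
  have "(LINT \<omega>|\<nu>. real_of_int (\<omega> 0)) = (LINT \<omega>|\<nu>. indicator (A 1) \<omega> - indicator (A (-1)) \<omega>)"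
    by (intro Bochner_Integration.integral_cong)
      (auto simp: inv(2) A_def indicator_def dest: OmegaD[of _ 0])
  also have "\<dots> = measure \<nu> (A 1) - measure \<nu> (A (-1))"
    using A by (subst Bochner_Integration.integral_diff) (auto simp: Int_absorb2 sets.sets_into_space less_top[symmetric])
  finally show ?thesis
    using eq by simp
qed

section \<open>Ergodic decomposition\<close>

text \<open>Cylinders form an intersection-stable generator. They suit the ergodic decomposition
  because their indicators are continuous test functions.\<close>

lemma measure_eqI_cylinders:
  assumes M: "sets M = sets Omega_borel" and N: "sets N = sets Omega_borel"
    and fin: "finite_measure M"
    and eq: "\<And>A. finite {i. A i \<noteq> UNIV} \<Longrightarrow>
      emeasure M {\<omega> \<in> Omega. \<forall>i. \<omega> i \<in> A i} = emeasure N {\<omega> \<in> Omega. \<forall>i. \<omega> i \<in> A i}"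
  shows "M = N"
proof -
  define E where "E = {{\<omega> \<in> Omega. \<forall>i. \<omega> i \<in> A i} | A. finite {i. A i \<noteq> UNIV}}"
  define G :: "(int \<Rightarrow> int) set set" where "G = {{f. f i \<in> A} | i A. True}"
  have E_Pow: "E \<subseteq> Pow Omega"
    by (auto simp: E_def)
  \<comment> \<open>Every subset of the discrete space \<open>int\<close> is Borel, so conditions on
    single coordinates generate the product Borel sets; the generator is then traced on
    \<open>Omega\<close>.\<close>
  have "sets (borel :: (int \<Rightarrow> int) measure) = sigma_sets UNIV G"
  proof -
    have "sets (borel :: int measure) = UNIV"
      using borel_open[OF Topological_Spaces.open_discrete] by auto
    then show ?thesis
      unfolding sets_PiM_equal_borel[symmetric] sets_PiM_single G_def
      by (simp add: PiE_UNIV_domain)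
  qed
  then have borel: "sets (borel :: (int \<Rightarrow> int) measure) = sets (sigma UNIV G)"
    by simp
  have "sets Omega_borel = sets (vimage_algebra Omega (\<lambda>x. x) borel)"
    unfolding Omega_borel_def by (rule restrict_space_eq_vimage_algebra) simp
  also have "\<dots> = sets (vimage_algebra Omega (\<lambda>x. x) (sigma UNIV G))"
    by (simp only: vimage_algebra_cong[OF refl refl borel])
  also have "\<dots> = sets (sigma Omega {(\<lambda>x. x) -` A \<inter> Omega | A. A \<in> G})"
    by (subst vimage_algebra_sigma) auto
  also have "\<dots> = sigma_sets Omega {(\<lambda>x. x) -` A \<inter> Omega | A. A \<in> G}"
    by (rule sets_measure_of) auto
  also have "\<dots> \<subseteq> sigma_sets Omega E"
  proof (rule sigma_sets_mono', safe)
    fix A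
    assume "A \<in> G"
    then obtain i B where A: "A = {f. f i \<in> B}"
      by (auto simp: G_def)
    have "finite {j. (if j = i then B else UNIV) \<noteq> UNIV}"
      by (rule finite_subset[of _ "{i}"]) auto
    then show "(\<lambda>x. x) -` A \<inter> Omega \<in> E"
      unfolding E_def A by (intro CollectI exI[of _ "\<lambda>j. if j = i then B else UNIV"]) auto
  qed
  finally have sub: "sets Omega_borel \<subseteq> sigma_sets Omega E" .
  have "X \<in> sets Omega_borel" if X: "X \<in> E" for X
  proof -
    obtain A where A: "finite {i. A i \<noteq> UNIV}" "X = {\<omega> \<in> Omega. \<forall>i. \<omega> i \<in> A i}"
      using X unfolding E_def by blast
    have "X = (\<Inter>i. (\<lambda>\<omega>. \<omega> i) -` A i \<inter> space Omega_borel)"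
      by (auto simp: A)
    also have "\<dots> \<in> sets Omega_borel"
      using measurable_sets[OF measurable_coordinate] by (intro sets.countable_INT) auto
    finally show ?thesis .
  qed
  then have gen: "sets Omega_borel = sigma_sets Omega E"
    using sub sets.sigma_sets_subset[of E Omega_borel] by auto
  show ?thesis
  proof (rule measure_eqI_generator_eq[where E=E and \<Omega>=Omega and A="\<lambda>_. Omega"])
    show "Int_stable E"
      unfolding Int_stable_def E_def
    proof safe
      fix A B :: "int \<Rightarrow> int set"
      assume "finite {i. A i \<noteq> UNIV}" "finite {i. B i \<noteq> UNIV}"
      then have "finite {i. A i \<inter> B i \<noteq> UNIV}"
        by (rule finite_subset[OF _ finite_UnI, rotated]) auto
      then show "\<exists>C. {\<omega> \<in> Omega. \<forall>i. \<omega> i \<in> A i} \<inter> {\<omega> \<in> Omega. \<forall>i. \<omega> i \<in> B i} =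
          {\<omega> \<in> Omega. \<forall>i. \<omega> i \<in> C i} \<and> finite {i. C i \<noteq> UNIV}"
        by (intro exI[of _ "\<lambda>i. A i \<inter> B i"]) auto
    qed
    show "range (\<lambda>_ :: nat. Omega) \<subseteq> E"
      by (auto simp: E_def intro!: exI[of _ "\<lambda>_. UNIV"])
    show "emeasure M Omega \<noteq> \<infinity>"
      using finite_measure.emeasure_finite[OF fin] by simp
  qed (use eq E_Pow in \<open>auto simp: M N gen E_def\<close>)
qed

lemma continuous_on_cylinder_indicator:
  assumes "finite {i :: int. A i \<noteq> (UNIV :: int set)}"
  shows "continuous_on S (indicator {\<omega>. \<forall>i. \<omega> i \<in> A i} :: (int \<Rightarrow> int) \<Rightarrow> real)"
proof -
  \<comment> \<open>The indicator is a finite product of functions of one discrete coordinate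
    each.\<close>
  have "continuous_on S (\<lambda>\<omega>. \<Prod>i\<in>{i. A i \<noteq> UNIV}. indicator (A i) (\<omega> i) :: real)"
  proof (rule continuous_on_prod)
    fix i
    show "continuous_on S (\<lambda>\<omega>. indicator (A i) (\<omega> i) :: real)"
    proof (rule continuous_on_compose2[of UNIV "indicator (A i)" S "\<lambda>\<omega>. \<omega> i"])
      show "continuous_on S (\<lambda>\<omega>. \<omega> i)"
        by (rule continuous_on_subset[OF continuous_on_product_coordinates]) simp
    qed (auto intro: Topological_Spaces.continuous_on_discrete)
  qed
  also have "(\<lambda>\<omega>. \<Prod>i\<in>{i. A i \<noteq> UNIV}. indicator (A i) (\<omega> i) :: real) = indicator {\<omega>. \<forall>i. \<omega> i \<in> A i}"
    using assms by (intro ext) (auto simp: indicator_def prod.neutral)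
  finally show ?thesis .
qed

text \<open>Extends the integral identity from continuous functions to Borel sets, so that null sets
  of \<open>\<mu>\<close> can be passed to its components.\<close>

lemma ergodic_decomposition_bind:
  assumes \<mu>: "\<mu> \<in> invariant_measures" and dec: "is_ergodic_decomposition \<mu> \<Lambda>"
  shows "(\<lambda>\<nu>. \<nu>) \<in> measurable \<Lambda> (subprob_algebra Omega_borel)" (is ?meas)
    and "\<mu> = \<Lambda> \<bind> (\<lambda>\<nu>. \<nu>)"
proof -
  have \<Lambda>s: "sets \<Lambda> = sets (restrict_space (prob_algebra Omega_borel) invariant_measures)"
    and "prob_space \<Lambda>" and erg1: "emeasure \<Lambda> ergodic_measures = 1"
    and int: "\<And>f :: (int \<Rightarrow> int) \<Rightarrow> real. continuous_on Omega f \<Longrightarrow>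
        (LINT \<omega>|\<mu>. f \<omega>) = (LINT \<nu>:ergodic_measures|\<Lambda>. (LINT \<omega>|\<nu>. f \<omega>))"
    using dec by (auto simp: is_ergodic_decomposition_def)
  interpret \<Lambda>: prob_space \<Lambda> by fact
  show meas: ?meas
    unfolding measurable_cong_sets[OF \<Lambda>s refl] prob_algebra_def
    by (intro measurable_restrict_space1 measurable_ident_sets refl)
  have inv: "\<nu> \<in> invariant_measures" if "\<nu> \<in> space \<Lambda>" for \<nu>
    using that sets_eq_imp_space_eq[OF \<Lambda>s] by (auto simp: space_restrict_space)
  \<comment> \<open>A non-measurable set would have the default \<open>emeasure\<close> 0 rather
    than 1.\<close>
  have erg: "ergodic_measures \<in> sets \<Lambda>"
    using erg1 emeasure_notin_sets by fastforce
  have AE_erg: "AE \<nu> in \<Lambda>. \<nu> \<in> ergodic_measures"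
    using erg1 by (intro \<Lambda>.AE_prob_1) (simp add: measure_def)
  have sb: "sets (\<Lambda> \<bind> (\<lambda>\<nu>. \<nu>)) = sets Omega_borel"
    using inv \<Lambda>.not_empty by (intro sets_bind invariant_measuresD(1))
  show "\<mu> = \<Lambda> \<bind> (\<lambda>\<nu>. \<nu>)"
  proof (rule measure_eqI_cylinders)
    show "sets \<mu> = sets Omega_borel" "sets (\<Lambda> \<bind> (\<lambda>\<nu>. \<nu>)) = sets Omega_borel"
      using invariant_measuresD[OF \<mu>] sb by simp_all
    show "finite_measure \<mu>"
      using invariant_measuresD(3)[OF \<mu>] by (simp add: prob_space.finite_measure)
    fix A :: "int \<Rightarrow> int set"
    assume A: "finite {i. A i \<noteq> UNIV}"
    define f :: "(int \<Rightarrow> int) \<Rightarrow> real" where "f = indicator {\<omega>. \<forall>i. \<omega> i \<in> A i}"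
    have cont: "continuous_on UNIV f" and f0: "\<And>x. 0 \<le> f x" and f1: "\<And>x. f x \<le> 1"
      using continuous_on_cylinder_indicator[OF A] by (simp_all add: f_def indicator_def)
    have fm: "f \<in> borel_measurable Omega_borel"
      unfolding Omega_borel_def using cont
      by (intro measurable_restrict_space1 borel_measurable_continuous_onI)
    have nn: "(\<integral>\<^sup>+x. f x \<partial>\<nu>) = ennreal (LINT x|\<nu>. f x)" "0 \<le> (LINT x|\<nu>. f x)" "(LINT x|\<nu>. f x) \<le> 1"
      if "\<nu> \<in> invariant_measures" for \<nu>
    proof -
      interpret prob_space \<nu>
        using invariant_measuresD[OF that] by simp
      have "integrable \<nu> f"
        using fm f0 f1 measurable_cong_sets[OF invariant_measuresD(1)[OF that] refl]
        by (intro integrable_const_bound[where B=1]) auto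
      then show "(\<integral>\<^sup>+x. f x \<partial>\<nu>) = ennreal (LINT x|\<nu>. f x)" "(LINT x|\<nu>. f x) \<le> 1"
        using f0 f1 by (auto simp: nn_integral_eq_integral intro: integral_le_const)
      show "0 \<le> (LINT x|\<nu>. f x)"
        using f0 by simp
    qed
    have gm: "(\<lambda>\<nu>. LINT x|\<nu>. f x) \<in> borel_measurable \<Lambda>"
      using measurable_compose[OF meas integral_measurable_subprob_algebra[OF fm]] .
    have "(\<integral>\<^sup>+x. f x \<partial>\<mu>) = ennreal (LINT \<nu>:ergodic_measures|\<Lambda>. (LINT \<omega>|\<nu>. f \<omega>))"
      using int[OF continuous_on_subset[OF cont subset_UNIV]] nn[OF \<mu>] by simp
    also have "(LINT \<nu>:ergodic_measures|\<Lambda>. (LINT \<omega>|\<nu>. f \<omega>)) = (LINT \<nu>|\<Lambda>. (LINT \<omega>|\<nu>. f \<omega>))"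
      unfolding set_lebesgue_integral_def
    proof (rule integral_cong_AE)
      show "AE \<nu> in \<Lambda>. indicator ergodic_measures \<nu> *\<^sub>R (LINT \<omega>|\<nu>. f \<omega>) = (LINT \<omega>|\<nu>. f \<omega>)"
        using AE_erg by eventually_elim simp
    qed (use gm erg in measurable)
    also have "ennreal \<dots> = (\<integral>\<^sup>+\<nu>. ennreal (LINT \<omega>|\<nu>. f \<omega>) \<partial>\<Lambda>)"
    proof (rule nn_integral_eq_integral[symmetric])
      show "integrable \<Lambda> (\<lambda>\<nu>. LINT \<omega>|\<nu>. f \<omega>)"
        using gm nn inv by (intro \<Lambda>.integrable_const_bound[where B=1]) auto
    qed (use nn inv in auto)
    also have "\<dots> = (\<integral>\<^sup>+\<nu>. \<integral>\<^sup>+x. f x \<partial>\<nu> \<partial>\<Lambda>)"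
      using nn inv by (intro nn_integral_cong) auto
    also have "\<dots> = (\<integral>\<^sup>+x. f x \<partial>(\<Lambda> \<bind> (\<lambda>\<nu>. \<nu>)))"
      using fm meas by (intro nn_integral_bind[symmetric]) auto
    finally have eq: "(\<integral>\<^sup>+x. f x \<partial>\<mu>) = (\<integral>\<^sup>+x. f x \<partial>(\<Lambda> \<bind> (\<lambda>\<nu>. \<nu>)))" .
    have "emeasure K {\<omega> \<in> Omega. \<forall>i. \<omega> i \<in> A i} = (\<integral>\<^sup>+x. f x \<partial>K)" if K: "sets K = sets Omega_borel" for K
    proof -
      have sp: "space K = Omega"
        using sets_eq_imp_space_eq[OF K] by simp
      have "f -` {1} \<inter> space Omega_borel \<in> sets K"
        using measurable_sets[OF fm, of "{1}"] by (simp add: K)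
      also have "f -` {1} \<inter> space Omega_borel = {\<omega> \<in> Omega. \<forall>i. \<omega> i \<in> A i}"
        by (auto simp: f_def indicator_def)
      finally have "emeasure K {\<omega> \<in> Omega. \<forall>i. \<omega> i \<in> A i} =
          (\<integral>\<^sup>+x. indicator {\<omega> \<in> Omega. \<forall>i. \<omega> i \<in> A i} x \<partial>K)"
        by simp
      also have "\<dots> = (\<integral>\<^sup>+x. f x \<partial>K)"
        by (intro nn_integral_cong) (auto simp: f_def sp indicator_def)
      finally show ?thesis .
    qed
    with eq show "emeasure \<mu> {\<omega> \<in> Omega. \<forall>i. \<omega> i \<in> A i} =
        emeasure (\<Lambda> \<bind> (\<lambda>\<nu>. \<nu>)) {\<omega> \<in> Omega. \<forall>i. \<omega> i \<in> A i}"
      using invariant_measuresD(1)[OF \<mu>] sb by simp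
  qed
qed

text \<open>A null set of a mixture is null for almost every component, so recurrence passes to the
  components.\<close>

lemma row_recurrent_components_mean_zero:
  assumes \<mu>: "\<mu> \<in> invariant_measures" and dec: "is_ergodic_decomposition \<mu> \<Lambda>"
    and rec: "AE \<omega> in \<mu>. row_recurrent \<omega>' \<omega>"
  shows "AE \<nu> in \<Lambda>. \<nu> \<in> ergodic_measures \<longrightarrow> (LINT \<omega>|\<nu>. real_of_int (\<omega> 0)) = 0"
proof -
  note b = ergodic_decomposition_bind[OF \<mu> dec]
  have "AE \<nu> in \<Lambda>. AE \<omega> in \<nu>. row_recurrent \<omega>' \<omega>"
    using rec AE_bind[OF b(1) pred_row_recurrent] b(2) by metis
  then show ?thesis
    by eventually_elim (auto simp: ergodic_measures_def intro: invariant_mean_zero)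
qed

text \<open>By invariance the hypothesis holds at each translate \<open>(x, y)\<close>. There are
  only countably many of these, so one \<omega>' serves for all of them.\<close>

lemma stable_imp_row_recurrent_AE:
  assumes \<mu>: "\<mu> \<in> invariant_measures" and \<mu>': "\<mu>' \<in> invariant_measures"
    and st: "AE \<omega>' in \<mu>'. AE \<omega> in \<mu>. \<forall>v\<in>N_dirs. has_stable_periodic_orbit (\<omega>, \<omega>', v)"
  shows "\<exists>\<omega>'. AE \<omega> in \<mu>. row_recurrent \<omega>' \<omega>"
proof -
  interpret \<mu>': prob_space \<mu>'
    using invariant_measuresD[OF \<mu>'] by simp
  have "AE \<omega>' in \<mu>'. AE \<omega> in \<mu>. \<forall>v\<in>N_dirs.
      has_stable_periodic_orbit (shift_pow x \<omega>, shift_pow y \<omega>', v)" for x y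
    using AE_shift_pow[OF \<mu>' st, of y] by eventually_elim (rule AE_shift_pow[OF \<mu>])
  then have "AE \<omega>' in \<mu>'. \<forall>x y. AE \<omega> in \<mu>. \<forall>v\<in>N_dirs.
      has_stable_periodic_orbit (shift_pow x \<omega>, shift_pow y \<omega>', v)"
    by (simp add: AE_all_countable)
  then have "AE \<omega>' in \<mu>'. \<omega>' \<in> Omega \<and> (\<forall>x y. AE \<omega> in \<mu>. \<forall>v\<in>N_dirs.
      has_stable_periodic_orbit (shift_pow x \<omega>, shift_pow y \<omega>', v))"
    using AE_space by eventually_elim (simp add: invariant_measuresD[OF \<mu>'])
  then obtain \<omega>' where \<omega>': "\<omega>' \<in> Omega"
    and all: "\<forall>x y. AE \<omega> in \<mu>. \<forall>v\<in>N_dirs. has_stable_periodic_orbit (shift_pow x \<omega>, shift_pow y \<omega>', v)"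
    using eventually_happens'[OF \<mu>'.ae_filter_bot] by blast
  \<comment> \<open>The velocity to be used in row \<open>y\<close> depends on
    \<open>\<omega>' y\<close>; it is covered because stability is known for every
    direction.\<close>
  have v: "(\<omega>' y, 0) \<in> N_dirs" for y
    using OmegaD[OF \<omega>', of y] by (auto simp: N_dirs_def)
  have "AE \<omega> in \<mu>. \<forall>x y. \<forall>v\<in>N_dirs. has_stable_periodic_orbit (shift_pow x \<omega>, shift_pow y \<omega>', v)"
    using all by (simp add: AE_all_countable)
  then have "AE \<omega> in \<mu>. row_recurrent \<omega>' \<omega>"
    using AE_space
  proof eventually_elim
    case (elim \<omega>)
    then have "\<omega> \<in> Omega"
      by (simp add: invariant_measuresD[OF \<mu>])
    with elim v show ?case
      unfolding row_recurrent_def by (blast intro: stable_imp_row_recurrent[OF _ \<omega>'])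
  qed
  then show ?thesis
    by (intro exI[of _ \<omega>'])
qed

section \<open>The direction measure and the passage from the product measure to sections\<close>

lemma AE_mu_N: "(AE v in mu_N. P v) \<longleftrightarrow> (\<forall>v\<in>N_dirs. P v)"
proof -
  have "0 < ennreal (1 / real (card N_dirs))"
    by (simp add: N_dirs_def)
  then show ?thesis
    unfolding mu_N_def uniform_count_measure_def AE_point_measure by simp
qed

lemma prob_space_mu_N: "prob_space mu_N"
  unfolding mu_N_def by (rule prob_space_uniform_count_measure) (auto simp: N_dirs_def)

lemma space_mu_N: "space mu_N = N_dirs"
  by (simp add: mu_N_def space_uniform_count_measure)

lemma swap_N_dirs: "(a, b) \<in> N_dirs \<Longrightarrow> (b, a) \<in> N_dirs"
  by (auto simp: N_dirs_def)

theorem corollary10: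
  fixes \<mu> \<mu>' :: "(int \<Rightarrow> int) measure"
    and \<Lambda> \<Lambda>' :: "(int \<Rightarrow> int) measure measure"
  assumes "\<mu> \<in> invariant_measures"
    and "\<mu>' \<in> invariant_measures"
    and "is_ergodic_decomposition \<mu> \<Lambda>"
    and "is_ergodic_decomposition \<mu>' \<Lambda>'"
    and "emeasure (\<mu> \<Otimes>\<^sub>M \<mu>' \<Otimes>\<^sub>M mu_N) {p \<in> X_space. \<not> has_stable_periodic_orbit p} = 0"
  shows "(AE \<nu> in \<Lambda>. \<nu> \<in> ergodic_measures \<longrightarrow> (LINT \<omega>|\<nu>. real_of_int (\<omega> 0)) = 0) \<and>
    (AE \<nu> in \<Lambda>'. \<nu> \<in> ergodic_measures \<longrightarrow> (LINT \<omega>|\<nu>. real_of_int (\<omega> 0)) = 0)"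
proof -
  note inv = invariant_measuresD[OF assms(1)] and inv' = invariant_measuresD[OF assms(2)]
  interpret \<mu>: prob_space \<mu> by (rule inv(3))
  interpret \<mu>': prob_space \<mu>' by (rule inv'(3))
  interpret N: prob_space mu_N by (rule prob_space_mu_N)
  interpret Q: pair_prob_space \<mu>' mu_N ..
  interpret P: pair_prob_space \<mu> "\<mu>' \<Otimes>\<^sub>M mu_N" ..
  interpret R: pair_prob_space \<mu> \<mu>' ..
  let ?B = "{p \<in> X_space. \<not> has_stable_periodic_orbit p}"
  have B: "?B \<in> sets (\<mu> \<Otimes>\<^sub>M \<mu>' \<Otimes>\<^sub>M mu_N)"
    by (rule no_stable_periodic_orbit_measurable[OF inv(1) inv'(1)])
  have "AE p in \<mu> \<Otimes>\<^sub>M \<mu>' \<Otimes>\<^sub>M mu_N. has_stable_periodic_orbit p"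
    using assms(5) B
    by (intro AE_I[where N="?B"]) (auto simp: space_pair_measure X_space_def inv inv' space_mu_N)
  then have "AE \<omega> in \<mu>. AE q in \<mu>' \<Otimes>\<^sub>M mu_N. has_stable_periodic_orbit (\<omega>, q)"
    by (rule P.AE_pair)
  \<comment> \<open>All directions have positive mass, so almost every direction means every
    direction.\<close>
  then have AE1: "AE \<omega> in \<mu>. AE \<omega>' in \<mu>'. \<forall>v\<in>N_dirs. has_stable_periodic_orbit (\<omega>, \<omega>', v)"
  proof eventually_elim
    case (elim \<omega>)
    then show ?case
      using Q.AE_pair[of "\<lambda>q. has_stable_periodic_orbit (\<omega>, q)"] by (simp add: AE_mu_N)
  qed
  \<comment> \<open>Exchanging the almost-everywhere quantifiers requires a measurable event; this
    one is the complement of the finitely many direction sections of \<open>?B\<close>.\<close>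
  have meas: "{p \<in> space (\<mu> \<Otimes>\<^sub>M \<mu>'). \<forall>v\<in>N_dirs. has_stable_periodic_orbit (fst p, snd p, v)} \<in> sets (\<mu> \<Otimes>\<^sub>M \<mu>')"
  proof -
    have bad: "(\<lambda>p. (fst p, snd p, v)) -` ?B \<inter> space (\<mu> \<Otimes>\<^sub>M \<mu>') \<in> sets (\<mu> \<Otimes>\<^sub>M \<mu>')"
      if "v \<in> N_dirs" for v
      using that by (intro measurable_sets[OF _ B] measurable_Pair) (auto simp: space_mu_N)
    have "space (\<mu> \<Otimes>\<^sub>M \<mu>') - (\<Union>v\<in>N_dirs. (\<lambda>p. (fst p, snd p, v)) -` ?B \<inter> space (\<mu> \<Otimes>\<^sub>M \<mu>')) \<in> sets (\<mu> \<Otimes>\<^sub>M \<mu>')"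
      using bad by (intro sets.compl_sets sets.finite_UN) (auto simp: N_dirs_def)
    then show ?thesis
      by (rule back_subst[of "\<lambda>A. A \<in> sets (\<mu> \<Otimes>\<^sub>M \<mu>')"])
        (auto simp: space_pair_measure X_space_def inv inv')
  qed
  have AE2: "AE \<omega>' in \<mu>'. AE \<omega> in \<mu>. \<forall>v\<in>N_dirs. has_stable_periodic_orbit (\<omega>, \<omega>', v)"
    using AE1 R.AE_commute[of "\<lambda>\<omega> \<omega>'. \<forall>v\<in>N_dirs. has_stable_periodic_orbit (\<omega>, \<omega>', v)"] meas by simp
  \<comment> \<open>For the second claim \<omega> is the sequence to be fixed, so the order of
    quantifiers in \<open>AE1\<close> is kept and the coordinates of the state are swapped.\<close>
  have AE1': "AE \<omega> in \<mu>. AE \<omega>' in \<mu>'. \<forall>v\<in>N_dirs. has_stable_periodic_orbit (\<omega>', \<omega>, v)"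
    using AE1
  proof eventually_elim
    case (elim \<omega>)
    then show ?case
      by eventually_elim (auto intro: has_stable_periodic_orbit_swap dest: swap_N_dirs)
  qed
  show ?thesis
    using stable_imp_row_recurrent_AE[OF assms(1,2) AE2] stable_imp_row_recurrent_AE[OF assms(2,1) AE1']
      row_recurrent_components_mean_zero assms(1-4) by blast
qed

end
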